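(* Let $n$ be a composite positive integer for which there exists a positive integer $M$ with $M\,S_2(n) = \phi(n) - 1$, where $\phi$ is Euler's totient function and $S_2(n) = n\prod_{p \mid n}\left(1 - \frac{2}{p}\right)$ (product over the distinct primes $p$ dividing $n$). Then $n$ is odd, $n$ is squarefree, and $\omega(n) \geq 7$, where $\omega(n)$ denotes the number of distinct prime divisors of $n$.
   Context: $S_2$ is Schemmel's totient function, $S_2(n) = n\prod_{p\mid n}(1-2/p)$. A composite integer $n$ satisfying $M S_2(n) = \phi(n)-1$ for some positive integer $M$ is called a Deaconescu number. $\omega(n)$ is the number of distinct prime factors of $n$. *)

theory Defs
  imports "HOL-Number_Theory.Number_Theory" "HOL-Computational_Algebra.Squarefree"
begin

definition schemmel_S2 :: "nat \<Rightarrow> real" where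
  "schemmel_S2 n = real n * (\<Prod>p\<in>prime_factors n. 1 - 2 / real p)"

definition prime_omega :: "nat \<Rightarrow> nat" where
  "prime_omega n = card (prime_factors n)"

definition composite :: "nat \<Rightarrow> bool" where
  "composite n \<longleftrightarrow> n > 1 \<and> \<not> prime n"

text \<open>
  The defining equation is stated over the reals, so the subtraction of 1 is not truncated.
\<close>

definition deaconescu_number :: "nat \<Rightarrow> bool" where
  "deaconescu_number n \<longleftrightarrow>
     composite n \<and> (\<exists>M::nat. M > 0 \<and> real M * schemmel_S2 n = real (totient n) - 1)"

end

(*
  After clearing denominators M * prod (p - 2) + 1 = prod (p - 1), where M is odd, since the right
  side is even, and M > 1, since n is composite.  If n had at most six prime factors, then
  M < prod (p - 1) / (p - 2), and this product only grows when the i-th prime factor is replaced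
  by the i-th odd number from 3 on, or from 5 on if 3 does not divide n.  For 3, 5, ..., 13 it is
  less than 5 and for 5, 7, ..., 15 it is less than 3, so M = 3 and 3 divides n.  Then 3 does not
  divide prod (p - 1), so every other prime factor is 2 mod 3 and prod (p - 1) = 2 mod 3, whereas
  the equation says that it is 1 mod 3.
*)
theory Submission
  imports Defs
begin

text \<open>The i-th smallest element of \<open>S\<close>, counted from 0, is at least
  \<open>m + i\<close>, so its factor is at most \<open>f (m + i)\<close>; interval factors left
  unmatched are at least 1. The induction avoids sorting: any \<open>x \<ge> m + k\<close> is
  matched with the last factor, and if there is none, \<open>S\<close> lies inside the
  interval.\<close>

lemma prod_le_prod_interval:
  fixes f :: "nat \<Rightarrow> 'a :: linordered_idom"
  assumes "S \<subseteq> {m..}" "finite S" "card S \<le> k"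
    and ge1: "\<And>i. m \<le> i \<Longrightarrow> 1 \<le> f i"
    and anti: "\<And>i j. m \<le> i \<Longrightarrow> i \<le> j \<Longrightarrow> f j \<le> f i"
  shows "prod f S \<le> prod f {m..<m + k}"
  using assms(1-3)
proof (induction k arbitrary: S)
  case 0
  then show ?case by simp
next
  case (Suc k)
  have nonneg: "0 \<le> f i" if "m \<le> i" for i
    using ge1[OF that] zero_le_one order_trans by blast
  show ?case
  proof (cases "\<exists>x\<in>S. m + k \<le> x")
    case True
    then obtain x where x: "x \<in> S" "m + k \<le> x" by blast
    have "prod f (S - {x}) \<le> prod f {m..<m + k}"
      using Suc.prems x by (intro Suc.IH) auto
    moreover have "f x \<le> f (m + k)" using anti x by simp
    ultimately have "f x * prod f (S - {x}) \<le> f (m + k) * prod f {m..<m + k}"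
      using Suc.prems nonneg by (intro mult_mono prod_nonneg) auto
    then show ?thesis
      using x Suc.prems by (simp add: prod.remove mult.commute)
  next
    case False
    then have "S \<subseteq> {m..<m + Suc k}" using Suc.prems by fastforce
    then show ?thesis using ge1 nonneg Suc.prems
      by (intro prod_mono2) (auto simp: subset_iff)
  qed
qed

text \<open>Writing \<open>p = 2 * i + 1\<close> turns \<open>(p - 1) / (p - 2)\<close> into
  \<open>2 * i / (2 * i - 1)\<close>, which is at least 1 and decreases in \<open>i\<close>. Since
  \<open>p div 2\<close> is injective on odd numbers, the worst case is a run of \<open>k\<close>
  consecutive odd numbers from \<open>2 * m + 1\<close> on.\<close>

lemma prod_odd_le_prod_interval:
  assumes "finite P" "card P \<le> k" "m \<ge> 1" "\<And>p. p \<in> P \<Longrightarrow> odd p \<and> p \<ge> 2 * m + 1"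
  shows "(\<Prod>p\<in>P. (real p - 1) / (real p - 2)) \<le> (\<Prod>i = m..<m + k. 2 * real i / (2 * real i - 1))"
proof -
  have half: "p = 2 * (p div 2) + 1" if "p \<in> P" for p
    using assms(4)[OF that] by presburger
  have inj: "inj_on (\<lambda>p. p div 2) P"
    using half by (intro inj_onI) metis
  have "(\<Prod>p\<in>P. (real p - 1) / (real p - 2))
      = (\<Prod>p\<in>P. 2 * real (p div 2) / (2 * real (p div 2) - 1))"
  proof (rule prod.cong)
    fix p assume "p \<in> P"
    from half[OF this] have "real p = 2 * real (p div 2) + 1" by linarith
    then show "(real p - 1) / (real p - 2) = 2 * real (p div 2) / (2 * real (p div 2) - 1)"
      by simp
  qed simp
  also have "\<dots> = (\<Prod>i\<in>(\<lambda>p. p div 2) ` P. 2 * real i / (2 * real i - 1))"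
    by (simp add: prod.reindex[OF inj])
  also have "\<dots> \<le> (\<Prod>i = m..<m + k. 2 * real i / (2 * real i - 1))"
  proof (rule prod_le_prod_interval)
    show "(\<lambda>p. p div 2) ` P \<subseteq> {m..}" using assms(4) by fastforce
    show "card ((\<lambda>p. p div 2) ` P) \<le> k" using assms(2) inj by (simp add: card_image)
    show "1 \<le> 2 * real i / (2 * real i - 1)" if "m \<le> i" for i
      using that assms(3) by (simp add: field_simps)
    show "2 * real j / (2 * real j - 1) \<le> 2 * real i / (2 * real i - 1)"
      if "m \<le> i" "i \<le> j" for i j
      using that assms(3) by (simp add: field_simps)
  qed (use assms in auto)
  finally show ?thesis .
qed

text \<open>This integral form parallels the product formula for \<open>totient\<close>, with
  \<open>p - 2\<close> in place of \<open>p - 1\<close>. The truncated subtraction is exact because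
  primes are at least 2.\<close>

lemma schemmel_S2_formula:
  assumes "n > 0"
  shows "schemmel_S2 n = real (\<Prod>p\<in>prime_factors n. p ^ (multiplicity p n - 1) * (p - 2))"
proof -
  have "real n = (\<Prod>p\<in>prime_factors n. real p ^ multiplicity p n)"
    using arg_cong[OF prime_factorization_nat[OF assms], of real]
    unfolding of_nat_prod of_nat_power .
  then have "schemmel_S2 n
      = (\<Prod>p\<in>prime_factors n. real p ^ multiplicity p n * (1 - 2 / real p))"
    unfolding schemmel_S2_def prod.distrib by (rule arg_cong)
  also have "\<dots> = (\<Prod>p\<in>prime_factors n. real (p ^ (multiplicity p n - 1) * (p - 2)))"
  proof (rule prod.cong)
    fix p assume p: "p \<in> prime_factors n"
    then have "p \<ge> 2" using prime_ge_2_nat by auto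
    moreover have "multiplicity p n > 0" using p by (simp add: prime_factors_multiplicity)
    then obtain k where "multiplicity p n = Suc k" using gr0_implies_Suc by blast
    ultimately show "real p ^ multiplicity p n * (1 - 2 / real p)
        = real (p ^ (multiplicity p n - 1) * (p - 2))"
      by (simp add: of_nat_diff field_simps)
  qed simp
  finally show ?thesis by simp
qed

lemma deaconescu_numberE:
  assumes "deaconescu_number n"
  obtains M where "M > 0"
    "M * (\<Prod>p\<in>prime_factors n. p ^ (multiplicity p n - 1) * (p - 2)) + 1 = totient n"
proof -
  have n: "n > 0" using assms by (simp add: deaconescu_number_def composite_def)
  obtain M :: nat where M: "M > 0" "real M * schemmel_S2 n = real (totient n) - 1"
    using assms by (auto simp: deaconescu_number_def)
  then have "real (M * (\<Prod>p\<in>prime_factors n. p ^ (multiplicity p n - 1) * (p - 2)) + 1)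
      = real (totient n)"
    using schemmel_S2_formula[OF n] by simp
  then show ?thesis using M(1) that by (metis of_nat_eq_iff)
qed

text \<open>The prime 2 would contribute the factor \<open>2 - 2 = 0\<close>, which forces
  \<open>totient n = 1\<close> and hence \<open>n = 2\<close>, a prime.\<close>

lemma deaconescu_number_odd:
  assumes "deaconescu_number n"
  shows "odd n"
proof
  assume "even n"
  have n: "n > 1" "\<not> prime n"
    using assms by (auto simp: deaconescu_number_def composite_def)
  then have "2 \<in> prime_factors n" using \<open>even n\<close> by (simp add: prime_factors_dvd)
  then have "(\<Prod>p\<in>prime_factors n. p ^ (multiplicity p n - 1) * (p - 2)) = 0"
    by (intro prod_zero) auto
  moreover obtain M where
    "M * (\<Prod>p\<in>prime_factors n. p ^ (multiplicity p n - 1) * (p - 2)) + 1 = totient n"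
    using assms by (elim deaconescu_numberE)
  ultimately have "totient n = 1" by (metis add_0 mult_0_right)
  then have "n = 2" using totient_gt_1[of n] n by linarith
  then show False using n by simp
qed

text \<open>If the square of \<open>p\<close> divides \<open>n\<close>, a factor \<open>p\<close>
  survives both in the product for \<open>schemmel_S2\<close> and in \<open>totient n\<close>, so
  \<open>p\<close> divides 1.\<close>

lemma deaconescu_number_squarefree:
  assumes "deaconescu_number n"
  shows "squarefree n"
proof -
  have n: "n > 1"
    using assms by (auto simp: deaconescu_number_def composite_def)
  obtain M where M:
    "M * (\<Prod>p\<in>prime_factors n. p ^ (multiplicity p n - 1) * (p - 2)) + 1 = totient n"
    using assms by (elim deaconescu_numberE)
  have "\<not> p\<^sup>2 dvd n" if p: "prime p" for p
  proof
    assume p2: "p\<^sup>2 dvd n"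
    then have pn: "p \<in> prime_factors n"
      using p n dvd_trans[of p "p\<^sup>2" n] by (simp add: prime_factors_dvd)
    have "multiplicity p n \<ge> 2"
      using p2 n p by (intro multiplicity_geI) auto
    then have pm: "p dvd p ^ (multiplicity p n - 1)" by (intro dvd_power) auto
    \<comment> \<open>A general \<open>g\<close> lets one fact serve both \<open>q - 1\<close> and
      \<open>q - 2\<close>.\<close>
    have dvd: "p dvd (\<Prod>q\<in>prime_factors n. q ^ (multiplicity q n - 1) * g q)" for g :: "nat \<Rightarrow> nat"
      using dvd_mult2[OF pm] dvd_prodI[OF finite_set_mset pn] by (rule dvd_trans)
    have "p dvd totient n"
      using dvd[of "\<lambda>q. q - 1"] n by (simp only: totient_formula1)
    moreover have "p dvd M * (\<Prod>p\<in>prime_factors n. p ^ (multiplicity p n - 1) * (p - 2))"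
      using dvd by (rule dvd_mult)
    ultimately have "p dvd 1" using dvd_add_right_iff unfolding M[symmetric] by blast
    then show False using p by simp
  qed
  then show ?thesis using n by (simp add: squarefree_factorial_semiring)
qed

text \<open>Used to find two distinct prime factors of a composite squarefree number.\<close>

lemma squarefree_prime_if_prime_factors_singleton:
  assumes "squarefree n" "prime_factors n = {p}"
  shows "prime (n::nat)"
proof -
  have "n > 0" using assms(1) by (metis gr0I not_squarefree_0)
  moreover have "multiplicity p n = 1"
    using assms \<open>n > 0\<close> by (simp add: squarefree_factorial_semiring')
  ultimately have "n = p" using prime_factorization_nat[of n] assms(2) by simp
  then show ?thesis using assms(2) by (metis in_prime_factors_imp_prime singletonI)
qed

text \<open>Rules out \<open>M = 1\<close>. Splitting off \<open>p\<close> gives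
  \<open>(p - 1) * A = (p - 2) * A + A\<close>, where \<open>A \<ge> B\<close>, and
  \<open>A \<ge> 2\<close> thanks to the second element \<open>q\<close>.\<close>

lemma prod_diff_2_less:
  fixes P :: "nat set"
  assumes "finite P" "p \<in> P" "q \<in> P" "p \<noteq> q" "\<And>x. x \<in> P \<Longrightarrow> x \<ge> 3"
  shows "(\<Prod>x\<in>P. x - 2) + 1 < (\<Prod>x\<in>P. x - 1)"
proof -
  define A where "A = (\<Prod>x\<in>P - {p}. x - 1)"
  define B where "B = (\<Prod>x\<in>P - {p}. x - 2)"
  have "B \<le> A" unfolding A_def B_def by (intro prod_mono) auto
  have "q - 1 dvd A" unfolding A_def using assms by (intro dvd_prodI) auto
  moreover have "x - 1 > 0" if "x \<in> P" for x using assms(5)[OF that] by simp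
  then have "A > 0" unfolding A_def by (intro prod_pos) auto
  ultimately have "q - 1 \<le> A" by (rule dvd_imp_le)
  then have "A \<ge> 2" using assms(5)[OF assms(3)] by linarith
  have "(p - 2) * B + 1 < (p - 2) * A + A"
    using \<open>A \<ge> 2\<close> mult_le_mono2[OF \<open>B \<le> A\<close>, of "p - 2"] by linarith
  also have "\<dots> = (p - 1) * A"
  proof -
    have "p - 1 = Suc (p - 2)" using assms(5)[OF assms(2)] by simp
    then show ?thesis by simp
  qed
  finally show ?thesis
    unfolding A_def B_def using assms by (simp add: prod.remove)
qed

text \<open>A prime in \<open>P\<close> other than 3 is neither 0 nor 1 mod 3, so its factor
  \<open>p - 1\<close> is 1 mod 3; only the prime 3 contributes a 2.\<close>

lemma prime_prod_diff_1_mod_3: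
  fixes P :: "nat set"
  assumes "finite P" "3 \<in> P" "\<And>p. p \<in> P \<Longrightarrow> prime p" "\<not> 3 dvd (\<Prod>p\<in>P. p - 1)"
  shows "[(\<Prod>p\<in>P. p - 1) = 2] (mod 3)"
proof -
  have "[p - 1 = 1] (mod 3)" if p: "p \<in> P - {3}" for p
  proof -
    have "\<not> 3 dvd p"
      using assms(3)[of p] p primes_dvd_imp_eq[of 3 p] by auto
    moreover have "\<not> 3 dvd p - 1"
      using assms(1,4) p dvd_prodI[of P p "\<lambda>p. p - 1"] dvd_trans by (metis DiffE)
    ultimately have "p mod 3 = 2" by presburger
    then have "p = 3 * (p div 3) + 2" by presburger
    then obtain k where "p = 3 * k + 2" by blast
    then show ?thesis by (simp add: cong_def)
  qed
  then have "[(\<Prod>p\<in>P - {3}. p - 1) = (\<Prod>p\<in>P - {3}. 1)] (mod 3)"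
    by (intro cong_prod)
  then have "[2 * (\<Prod>p\<in>P - {3}. p - 1) = 2 * 1] (mod 3)"
    by (intro cong_scalar_left) simp
  moreover have "(\<Prod>p\<in>P. p - 1) = 2 * (\<Prod>p\<in>P - {3}. p - 1)"
    using prod.remove[OF assms(1,2), of "\<lambda>p. p - 1"] by simp
  ultimately show ?thesis by simp
qed

lemma prime_omega_ge_7:
  assumes "deaconescu_number n"
  shows "prime_omega n \<ge> 7"
proof (rule ccontr)
  assume "\<not> prime_omega n \<ge> 7"
  define P where "P = prime_factors n"
  have fin: "finite P" and card: "card P \<le> 6"
    using \<open>\<not> prime_omega n \<ge> 7\<close> by (simp_all add: P_def prime_omega_def)
  have n: "n > 1" "\<not> prime n"
    using assms by (auto simp: deaconescu_number_def composite_def)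
  have sqf: "squarefree n" by (rule deaconescu_number_squarefree[OF assms])
  have prime: "prime p" if "p \<in> P" for p using that by (auto simp: P_def)
  have odd: "odd p" if "p \<in> P" for p
    using that deaconescu_number_odd[OF assms] dvd_trans[of 2 p n] by (auto simp: P_def)
  have ge3: "p \<ge> 3" if "p \<in> P" for p
    using prime_ge_2_nat[OF prime[OF that]] odd[OF that] by (cases "p = 2") auto
  have mult: "multiplicity p n = 1" if "p \<in> P" for p
    using that sqf n by (simp add: P_def squarefree_factorial_semiring')
  have tot: "totient n = (\<Prod>p\<in>P. p - 1)"
    using n mult by (subst totient_formula1) (auto simp: P_def intro!: prod.cong)
  have "(\<Prod>p\<in>P. p ^ (multiplicity p n - 1) * (p - 2)) = (\<Prod>p\<in>P. p - 2)"
    using mult by (intro prod.cong) auto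
  then obtain M where M: "M > 0" "M * (\<Prod>p\<in>P. p - 2) + 1 = (\<Prod>p\<in>P. p - 1)"
    using assms tot by (elim deaconescu_numberE) (simp add: P_def)

  have "P \<noteq> {}" using n by (simp add: P_def prime_factorization_empty_iff)
  then obtain p where p: "p \<in> P" by blast
  have "P \<noteq> {p}"
    using squarefree_prime_if_prime_factors_singleton[OF sqf] n(2) by (auto simp: P_def)
  then obtain q where q: "q \<in> P" "q \<noteq> p" using p by blast
  have "M \<noteq> 1"
    using prod_diff_2_less[OF fin p q(1)] q(2) ge3 M(2) by force
  moreover have "odd M"
  proof -
    have "p - 1 dvd (\<Prod>p\<in>P. p - 1)" using fin p by (intro dvd_prodI)
    then have "even (\<Prod>p\<in>P. p - 1)" using odd[OF p] dvd_trans[of 2 "p - 1"] by fastforce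
    then show ?thesis using M(2) by (metis even_mult_iff odd_add odd_one)
  qed
  ultimately have M3: "M = 3 \<or> M \<ge> 5" using M(1) by presburger

  have pos: "(\<Prod>p\<in>P. real p - 2) > 0"
    using ge3 by (intro prod_pos) fastforce
  have "real M * (\<Prod>p\<in>P. real p - 2) + 1 = (\<Prod>p\<in>P. real p - 1)"
  proof -
    have cast: "real p - k = real (p - k)" if "p \<in> P" "k \<le> 2" for p k :: nat
      using ge3[OF that(1)] that(2) by (simp add: of_nat_diff)
    have "(\<Prod>p\<in>P. real p - 2) = real (\<Prod>p\<in>P. p - 2)"
      using cast[of _ 2] by (simp cong: prod.cong)
    moreover have "(\<Prod>p\<in>P. real p - 1) = real (\<Prod>p\<in>P. p - 1)"
      using cast[of _ 1] by (simp cong: prod.cong)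
    ultimately show ?thesis using M(2) by (metis of_nat_1 of_nat_add of_nat_mult)
  qed
  \<comment> \<open>The summand 1 in the equation makes this inequality strict.\<close>
  then have Mless: "real M < (\<Prod>p\<in>P. (real p - 1) / (real p - 2))"
    using pos by (simp add: prod_dividef pos_less_divide_eq)
  also have "\<dots> \<le> (\<Prod>i = 1..<1 + 6. 2 * real i / (2 * real i - 1))"
    using fin card odd ge3 by (intro prod_odd_le_prod_interval) auto
  \<comment> \<open>The product for 3, 5, ..., 13 is about 4.43.\<close>
  also have "\<dots> < 5" by (simp add: prod.atLeast_Suc_lessThan)
  finally have "M = 3" using M3 by simp

  have "3 \<in> P"
  proof (rule ccontr)
    assume "3 \<notin> P"
    then have "p \<ge> 2 * 2 + 1" if "p \<in> P" for p
      \<comment> \<open>The value 4 is excluded by parity.\<close>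
      using ge3[OF that] odd[OF that] that by (cases "p = 3"; cases "p = 4") auto
    then have "(\<Prod>p\<in>P. (real p - 1) / (real p - 2))
        \<le> (\<Prod>i = 2..<2 + 6. 2 * real i / (2 * real i - 1))"
      using fin card odd by (intro prod_odd_le_prod_interval) auto
    \<comment> \<open>Without 3 the run is 5, 7, ..., 15, whose product is about 2.39.\<close>
    also have "\<dots> < 3" by (simp add: prod.atLeast_Suc_lessThan)
    finally show False using Mless \<open>M = 3\<close> by simp
  qed
  \<comment> \<open>Residue 1 serves twice: it shows that 3 does not divide the product, as the
    congruence lemma requires, and it contradicts the residue 2 obtained from that lemma.\<close>
  have mod1: "(\<Prod>p\<in>P. p - 1) mod 3 = 1"
    using M(2) \<open>M = 3\<close> mod_mult_self4[of 3 "\<Prod>p\<in>P. p - 2" 1] by simp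
  then have "[(\<Prod>p\<in>P. p - 1) = 2] (mod 3)"
    using fin \<open>3 \<in> P\<close> prime by (intro prime_prod_diff_1_mod_3) (auto simp: dvd_eq_mod_eq_0)
  then show False using mod1 by (simp add: cong_def)
qed

theorem theorem1p1:
  fixes n :: nat
  assumes "deaconescu_number n"
  shows "odd n \<and> squarefree n \<and> prime_omega n \<ge> 7"
  using assms deaconescu_number_odd deaconescu_number_squarefree prime_omega_ge_7 by blast

end
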